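(* Let $G,I,L,M,N,P,Q,R,S$ be any complex numbers and put $$\begin{aligned} A&=I+2L+2N+P+2Q+6R+4S-14,\\ E&=-I-2L-N-Q-3R-S+5,\\ F&=4G+I+2L+6N+5P+6Q+18R+16S-50,\\ H&=-L-2N-P-Q-4R-3S+10,\\ J&=-G-I-2L-M-2P-3Q-6R-7S+20,\\ K&=-2G-2M-2N-5P-2Q-6R-12S+30. \end{aligned}$$ Then for every integer $n\ge0$, $$\begin{aligned} &\sum_{k_1+\cdots+k_5=n}\binom{n}{k_1,\dots,k_5}T_{k_1}\cdots T_{k_5}\\ &=\frac{A}{563^2}5^nX_n+\frac{E}{563^2}\sum_{k=0}^n\binom nk4^{n-k}W_{n-k}T_k-\frac{F}{563}\sum_{k=0}^n\binom nkT_k\\ &\quad+G\sum_{k=0}^n\binom nkt_k^{1}T_{n-k}+\frac{H}{563^2}\sum_{k=0}^n\binom nk3^{n-k}2^kV_{n-k}U_k+\frac{I}{563}\sum_{k=0}^n\binom nk3^kV_kt_{n-k}\\ &\quad-\frac{J}{563^2}\sum_{k_1+k_2+k_3=n}\binom{n}{k_1,k_2,k_3}(-1)^{k_1}2^{k_2}Y_{k_1}U_{k_2}\\ &\quad-\frac{K}{563}\sum_{k_1+k_2+k_3=n}\binom{n}{k_1,k_2,k_3}(-1)^{k_1}Y_{k_1}t_{k_2}\\ &\quad+\frac{L}{563}\sum_{k_1+k_2+k_3=n}\binom{n}{k_1,k_2,k_3}3^{k_1}V_{k_1}T_{k_2}T_{k_3}\\ &\quad-\frac{M}{563}\sum_{k_1+k_2+k_3+k_4=n}\binom{n}{k_1,k_2,k_3,k_4}(-1)^{k_1}Y_{k_1}T_{k_2}T_{k_3}\\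 &\quad+\frac{N}{563^2}\sum_{k_1+k_2+k_3=n}\binom{n}{k_1,k_2,k_3}2^{k_1}U_{k_1}2^{k_2}U_{k_2}T_{k_3}\\ &\quad+P\sum_{k_1+k_2+k_3=n}\binom{n}{k_1,k_2,k_3}t_{k_1}t_{k_2}T_{k_3}\\ &\quad+\frac{Q}{563}\sum_{k_1+k_2+k_3=n}\binom{n}{k_1,k_2,k_3}2^{k_1}U_{k_1}t_{k_2}T_{k_3}\\ &\quad+\frac{R}{563}\sum_{k_1+k_2+k_3+k_4=n}\binom{n}{k_1,k_2,k_3,k_4}2^{k_1}U_{k_1}T_{k_2}T_{k_3}T_{k_4}\\ &\quad+S\sum_{k_1+k_2+k_3+k_4=n}\binom{n}{k_1,k_2,k_3,k_4}t_{k_1}T_{k_2}T_{k_3}T_{k_4}. \end{aligned}$$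
   Context: For given $s_0,s_1,s_2,s_3$, the sequence $T_n^{(s_0,s_1,s_2,s_3)}$ is defined by $T_j^{(s_0,s_1,s_2,s_3)}=s_j$ for $0\le j\le 3$ and, for $n\ge4$, each term being the sum of the four preceding terms. The Tetranacci numbers are $T_n=T_n^{(0,1,1,2)}$. Abbreviate $U_n=T_n^{(40,64,215,344)}$, $V_n=T_n^{(15,27,48,107)}$, $W_n=T_n^{(3052,4658,8804,16451)}$, $X_n=T_n^{(500,1423,2598,4986)}$, $Y_n=T_n^{(-5,2,13,32)}$, and $$t_n=\frac12\left(\sum_{k=0}^n\binom nkT_kT_{n-k}-\frac{2^n}{563}U_n\right).$$ All indices $k_i$ in sums run over nonnegative integers and $\binom{n}{k_1,\dots,k_r}=\frac{n!}{k_1!\cdots k_r!}$. Let $\lambda_1,\lambda_2,\lambda_3,\lambda_4$ be the (distinct, complex) roots of $x^4-x^3-x^2-x-1=0$ and $c_i=\frac1{-\lambda_i^3+6\lambda_i-1}$ (so $\sum_{n\ge0}T_n\frac{x^n}{n!}=\sum_{i=1}^4c_ie^{\lambda_ix}$). The numbers $t_n^1$ (superscript is an index, not a power) are defined by $$\sum_{n=0}^\infty t_n^{1}\frac{x^n}{n!}=\sum_{1\le i<j<l\le4}c_ic_jc_le^{(\lambda_i+\lambda_j+\lambda_l)x}\left(c_ie^{\lambda_ix}+c_je^{\lambda_jx}+c_le^{\lambda_lx}\right).$$ *)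

theory Defs
  imports "HOL-Computational_Algebra.Computational_Algebra"
begin

fun tetra :: "complex \<Rightarrow> complex \<Rightarrow> complex \<Rightarrow> complex \<Rightarrow> nat \<Rightarrow> complex" where
  "tetra s0 s1 s2 s3 0 = s0"
| "tetra s0 s1 s2 s3 (Suc 0) = s1"
| "tetra s0 s1 s2 s3 (Suc (Suc 0)) = s2"
| "tetra s0 s1 s2 s3 (Suc (Suc (Suc 0))) = s3"
| "tetra s0 s1 s2 s3 (Suc (Suc (Suc (Suc n)))) =
     tetra s0 s1 s2 s3 (Suc (Suc (Suc n))) + tetra s0 s1 s2 s3 (Suc (Suc n)) +
     tetra s0 s1 s2 s3 (Suc n) + tetra s0 s1 s2 s3 n"

definition seqT :: "nat \<Rightarrow> complex" where "seqT = tetra 0 1 1 2"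
definition seqU :: "nat \<Rightarrow> complex" where "seqU = tetra 40 64 215 344"
definition seqV :: "nat \<Rightarrow> complex" where "seqV = tetra 15 27 48 107"
definition seqW :: "nat \<Rightarrow> complex" where "seqW = tetra 3052 4658 8804 16451"
definition seqX :: "nat \<Rightarrow> complex" where "seqX = tetra 500 1423 2598 4986"
definition seqY :: "nat \<Rightarrow> complex" where "seqY = tetra (-5) 2 13 32"

definition seqt :: "nat \<Rightarrow> complex" where
  "seqt n = 1 / 2 * ((\<Sum>k=0..n. of_nat (n choose k) * seqT k * seqT (n - k)) - 2 ^ n / 563 * seqU n)"

definition coeff_c :: "complex \<Rightarrow> complex" where
  "coeff_c z = 1 / (- (z ^ 3) + 6 * z - 1)"

(* The defining identity of the numbers t^1_n is read as an identity of formal power series: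
   t^1_n is n! times the n-th coefficient of the series below, where fps_exp a is exp (a x).
   The argument lam enumerates the four roots as lam 1, ..., lam 4. *)
definition seqt1 :: "(nat \<Rightarrow> complex) \<Rightarrow> nat \<Rightarrow> complex" where
  "seqt1 lam n = fact n * fps_nth
     (\<Sum>(i, j, l) \<in> {(i, j, l). 1 \<le> i \<and> i < j \<and> j < l \<and> l \<le> (4::nat)}.
        fps_const (coeff_c (lam i) * coeff_c (lam j) * coeff_c (lam l)) *
        fps_exp (lam i + lam j + lam l) *
        (fps_const (coeff_c (lam i)) * fps_exp (lam i) +
         fps_const (coeff_c (lam j)) * fps_exp (lam j) +
         fps_const (coeff_c (lam l)) * fps_exp (lam l))) n"

definition multinom :: "nat \<Rightarrow> nat list \<Rightarrow> complex" where
  "multinom n ks = fact n / (\<Prod>k\<leftarrow>ks. fact k)"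

definition comps3 :: "nat \<Rightarrow> (nat \<times> nat \<times> nat) set" where
  "comps3 n = {(k1, k2, k3). k1 + k2 + k3 = n}"

definition comps4 :: "nat \<Rightarrow> (nat \<times> nat \<times> nat \<times> nat) set" where
  "comps4 n = {(k1, k2, k3, k4). k1 + k2 + k3 + k4 = n}"

definition comps5 :: "nat \<Rightarrow> (nat \<times> nat \<times> nat \<times> nat \<times> nat) set" where
  "comps5 n = {(k1, k2, k3, k4, k5). k1 + k2 + k3 + k4 + k5 = n}"

end

theory Submission
  imports Defs
begin

text \<open>
  A binomial or multinomial convolution is a product of exponential generating functions, so the
  claim is an identity between formal power series. Put \<open>x i = c i * exp (lam i * X)\<close> for
  the four roots. Then every sequence in the claim comes from a symmetric function of
  \<open>x 1, \<dots>, x 4\<close>.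

  \<^item> The sequences \<open>T\<close>, \<open>2 ^ n U\<close>, \<open>3 ^ n V\<close>, \<open>4 ^ n W\<close>, \<open>5 ^ n X\<close> give the power sums
    \<open>p 1, \<dots>, p 5\<close>, up to the factors 1, 563, 563, \<open>563 ^ 2\<close>, \<open>563 ^ 2\<close>. This holds because
    the powers of \<open>c i\<close> are polynomials of degree 3 in \<open>lam i\<close> (\<open>coeff_c_powers\<close>), so that sums of
    \<open>c i ^ r * lam i ^ n\<close> are combinations of power sums of the roots and solve the recurrence
    (\<open>weighted_power_sum\<close>); only the four initial values remain to be compared.
  \<^item> The numbers \<open>t\<close> give \<open>e2\<close>, by \<open>2 * e2 = e1 ^ 2 - p 2\<close>, and \<open>t1\<close> gives the monomial
    symmetric function of type \<open>(2,1,1)\<close>, which is \<open>e1 * e3 - 4 * e4\<close>.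
  \<^item> The roots add up to 1 and the product of the \<open>c i\<close> is \<open>-1/563\<close> (\<open>prod_cc\<close>), hence
    \<open>e4 = -exp X / 563\<close>. This accounts for the indices \<open>k\<close> that carry no sequence: their factor
    is \<open>exp X\<close>. Dividing \<open>e4\<close> by the single \<open>x i\<close> gives \<open>e3\<close> as \<open>-exp X / 563\<close> times the sum of
    \<open>exp (- lam i * X) / c i\<close>, which is the generating function of \<open>(-1) ^ n Y\<close> (\<open>egf_Y\<close>).

  What is left is a polynomial identity for \<open>e1 ^ 5\<close> (\<open>e1_power5_expansion\<close>). Symmetric polynomials
  of degree 5 in four variables form a space of dimension 6. The 15 products on the right-hand side
  lie in it, and the six with coefficients \<open>A, E, F, H, J, K\<close> form a basis; so the other nine
  coefficients \<open>G, I, L, \<dots>, S\<close> can be prescribed at will, and the six are then determined.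
\<close>

section \<open>Exponential generating functions\<close>

definition egf :: "(nat \<Rightarrow> complex) \<Rightarrow> complex fps" where
  "egf f = Abs_fps (\<lambda>n. f n / fact n)"

lemma egf_nth: "fact n * egf f $ n = f n"
  by (simp add: egf_def)

lemma egf_geometric: "egf (\<lambda>n. a ^ n) = fps_exp a"
  by (simp add: egf_def fps_eq_iff)

lemma egf_cmult: "egf (\<lambda>n. a * f n) = fps_const a * egf f"
  by (simp add: egf_def fps_eq_iff)

lemma egf_sum: "egf (\<lambda>n. \<Sum>i\<in>I. f i n) = (\<Sum>i\<in>I. egf (f i))"
  by (simp add: egf_def fps_eq_iff fps_sum_nth sum_divide_distrib)

lemma binomial_sum_egf:
  "(\<Sum>k=0..n. of_nat (n choose k) * (f k * g (n - k))) = fact n * (egf f * egf g) $ n"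
proof -
  have "of_nat (n choose k) * (f k * g (n - k)) = fact n * (egf f $ k * egf g $ (n - k))"
    if "k \<in> {0..n}" for k
    using that by (simp add: egf_def binomial_fact)
  then show ?thesis
    unfolding fps_mult_nth sum_distrib_left by (rule sum.cong[OF refl])
qed

text \<open>
  Multinomial convolutions are handled in two steps. The plain convolutions over \<open>comps3\<close>,
  \<open>comps4\<close>, \<open>comps5\<close> are coefficients of products of power series, each obtained from the previous
  one by splitting off the first index; the factorials in the multinomial coefficient are then
  absorbed by \<open>egf\<close>.
\<close>

lemma comps3_sum_nth:
  fixes a b c :: "complex fps"
  shows "(\<Sum>(i, j, k)\<in>comps3 n. a $ i * (b $ j * c $ k)) = (a * (b * c)) $ n"
proof -
  have "comps3 n = (\<lambda>(i, j). (i, j, n - i - j)) ` (SIGMA i:{0..n}. {0..n - i})"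
    by (force simp: comps3_def image_iff)
  moreover have "inj_on (\<lambda>(i, j). (i, j, n - i - j)) (SIGMA i:{0..n}. {0..n - i})"
    by (auto simp: inj_on_def)
  ultimately show ?thesis
    by (simp add: sum.reindex case_prod_unfold fps_mult_nth sum_distrib_left sum.Sigma)
qed

lemma comps4_sum_nth:
  fixes a b c d :: "complex fps"
  shows "(\<Sum>(i, j, k, l)\<in>comps4 n. a $ i * (b $ j * (c $ k * d $ l))) = (a * (b * (c * d))) $ n"
proof -
  have fin: "finite (comps3 m)" for m
    by (rule finite_subset[of _ "{0..m} \<times> {0..m} \<times> {0..m}"]) (auto simp: comps3_def)
  have "comps4 n = (SIGMA i:{0..n}. comps3 (n - i))"
    by (auto simp: comps3_def comps4_def)
  then have "(\<Sum>(i, j, k, l)\<in>comps4 n. a $ i * (b $ j * (c $ k * d $ l))) =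
      (\<Sum>i=0..n. \<Sum>(j, k, l)\<in>comps3 (n - i). a $ i * (b $ j * (c $ k * d $ l)))"
    by (simp add: sum.Sigma fin)
  also have "\<dots> = (\<Sum>i=0..n. a $ i * (\<Sum>(j, k, l)\<in>comps3 (n - i). b $ j * (c $ k * d $ l)))"
    by (simp add: sum_distrib_left case_prod_unfold)
  finally show ?thesis
    by (simp add: comps3_sum_nth fps_mult_nth[of a])
qed

lemma comps5_sum_nth:
  fixes a b c d e :: "complex fps"
  shows "(\<Sum>(i, j, k, l, m)\<in>comps5 n. a $ i * (b $ j * (c $ k * (d $ l * e $ m)))) =
    (a * (b * (c * (d * e)))) $ n"
proof -
  have fin: "finite (comps4 m)" for m
    by (rule finite_subset[of _ "{0..m} \<times> {0..m} \<times> {0..m} \<times> {0..m}"]) (auto simp: comps4_def)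
  have "comps5 n = (SIGMA i:{0..n}. comps4 (n - i))"
    by (auto simp: comps4_def comps5_def)
  then have "(\<Sum>(i, j, k, l, m)\<in>comps5 n. a $ i * (b $ j * (c $ k * (d $ l * e $ m)))) =
      (\<Sum>i=0..n. \<Sum>(j, k, l, m)\<in>comps4 (n - i). a $ i * (b $ j * (c $ k * (d $ l * e $ m))))"
    by (simp add: sum.Sigma fin)
  also have "\<dots> = (\<Sum>i=0..n. a $ i * (\<Sum>(j, k, l, m)\<in>comps4 (n - i). b $ j * (c $ k * (d $ l * e $ m))))"
    by (simp add: sum_distrib_left case_prod_unfold)
  finally show ?thesis
    by (simp add: comps4_sum_nth fps_mult_nth[of a])
qed

lemma multinom3_sum_egf:
  "(\<Sum>(i, j, k)\<in>comps3 n. multinom n [i, j, k] * (f i * (g j * h k))) =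
    fact n * (egf f * (egf g * egf h)) $ n"
  unfolding comps3_sum_nth[symmetric] sum_distrib_left
  by (rule sum.cong) (auto simp: multinom_def egf_def)

lemma multinom4_sum_egf:
  "(\<Sum>(i, j, k, l)\<in>comps4 n. multinom n [i, j, k, l] * (f i * (g j * (h k * u l)))) =
    fact n * (egf f * (egf g * (egf h * egf u))) $ n"
  unfolding comps4_sum_nth[symmetric] sum_distrib_left
  by (rule sum.cong) (auto simp: multinom_def egf_def)

lemma multinom5_sum_egf:
  "(\<Sum>(i, j, k, l, m)\<in>comps5 n. multinom n [i, j, k, l, m] * (f i * (g j * (h k * (u l * v m))))) =
    fact n * (egf f * (egf g * (egf h * (egf u * egf v)))) $ n"
  unfolding comps5_sum_nth[symmetric] sum_distrib_left
  by (rule sum.cong) (auto simp: multinom_def egf_def)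

section \<open>Symmetric functions of four variables\<close>

lemma newton_four:
  fixes a b c d :: "'a::idom"
  defines "e1 \<equiv> a + b + c + d"
    and "e2 \<equiv> a*b + a*c + a*d + b*c + b*d + c*d"
    and "e3 \<equiv> a*b*c + a*b*d + a*c*d + b*c*d"
    and "e4 \<equiv> a*b*c*d"
  shows "a^2 + b^2 + c^2 + d^2 = e1^2 - 2*e2"
    and "a^3 + b^3 + c^3 + d^3 = e1^3 - 3*e1*e2 + 3*e3"
    and "a^4 + b^4 + c^4 + d^4 = e1^4 - 4*e1^2*e2 + 2*e2^2 + 4*e1*e3 - 4*e4"
    and "a^5 + b^5 + c^5 + d^5 = e1^5 - 5*e1^3*e2 + 5*e1*e2^2 + 5*e1^2*e3 - 5*e2*e3 - 5*e1*e4"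
    and "a*b*c*(a + b + c) + a*b*d*(a + b + d) + a*c*d*(a + c + d) + b*c*d*(b + c + d)
      = e1*e3 - 4*e4"
  unfolding assms by algebra+

text \<open>
  By Newton's formulas all summands are polynomials in \<open>e1, \<dots>, e4\<close>, homogeneous of degree 5 when
  \<open>ei\<close> has degree \<open>i\<close>. Since both sides are affine in the nine free coefficients, this is one
  expansion of \<open>e1 ^ 5\<close> in the basis \<open>p5\<close>, \<open>p4 * e1\<close>, \<open>e4 * e1\<close>, \<open>p3 * p2\<close>, \<open>e3 * p2\<close>, \<open>e3 * e2\<close>
  together with nine linear relations.
\<close>

lemma e1_power5_expansion:
  fixes e1 e2 e3 e4 p2 p3 p4 p5 m :: "'a::idom"
  assumes p: "p2 = e1^2 - 2*e2" "p3 = e1^3 - 3*e1*e2 + 3*e3"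
    "p4 = e1^4 - 4*e1^2*e2 + 2*e2^2 + 4*e1*e3 - 4*e4"
    "p5 = e1^5 - 5*e1^3*e2 + 5*e1*e2^2 + 5*e1^2*e3 - 5*e2*e3 - 5*e1*e4"
    "m = e1*e3 - 4*e4"
  shows "e1^5 = (I + 2*L + 2*N + P + 2*Q + 6*R + 4*S - 14) * p5
    + (- I - 2*L - N - Q - 3*R - S + 5) * (p4*e1)
    + (4*G + I + 2*L + 6*N + 5*P + 6*Q + 18*R + 16*S - 50) * (e4*e1)
    + G * (m*e1)
    + (- L - 2*N - P - Q - 4*R - 3*S + 10) * (p3*p2)
    + I * (p3*e2)
    + (- G - I - 2*L - M - 2*P - 3*Q - 6*R - 7*S + 20) * (e3*p2)
    + (- 2*G - 2*M - 2*N - 5*P - 2*Q - 6*R - 12*S + 30) * (e3*e2)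
    + L * (p3*e1^2) + M * (e3*e1^2) + N * (p2^2*e1) + P * (e2^2*e1)
    + Q * (p2*e2*e1) + R * (p2*e1^3) + S * (e2*e1^3)"
  unfolding p by algebra

section \<open>Power sums of the roots\<close>

lemma tetra_add_4:
  "tetra a b c d (n + 4) = tetra a b c d (n + 3) + tetra a b c d (n + 2)
    + tetra a b c d (n + 1) + tetra a b c d n"
  by (simp add: numeral_eq_Suc)

lemma tetra_unique:
  assumes rec: "\<And>n. u (n + 4) = u (n + 3) + u (n + 2) + u (n + 1) + u n"
  shows "u n = tetra (u 0) (u 1) (u 2) (u 3) n"
proof (induction n rule: less_induct)
  case (less n)
  have "n = 0 \<or> n = 1 \<or> n = 2 \<or> n = 3 \<or> (\<exists>k. n = k + 4)" by presburger
  then consider "n = 0" | "n = 1" | "n = 2" | "n = 3" | k where "n = k + 4" by blast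
  then show ?case
  proof cases
    case 5
    then have "k < n" "k + 1 < n" "k + 2 < n" "k + 3 < n" by simp_all
    from this[THEN less.IH] show ?thesis
      unfolding 5 rec tetra_add_4 by (simp only:)
  qed (simp_all add: numeral_eq_Suc)
qed

lemma sum_1_4:
  fixes f :: "nat \<Rightarrow> 'a::comm_monoid_add"
  shows "(\<Sum>i=1..4. f i) = f 1 + f 2 + f 3 + f 4"
  by (simp add: numeral_eq_Suc add_ac)

locale tetranacci_roots =
  fixes lam :: "nat \<Rightarrow> complex"
  assumes roots: "bij_betw lam {1..4} {z. z ^ 4 - z ^ 3 - z ^ 2 - z - 1 = 0}"
begin

lemma root_power4: "i \<in> {1..4} \<Longrightarrow> lam i ^ 4 = lam i ^ 3 + lam i ^ 2 + lam i + 1"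
  using bij_betwE[OF roots] by (auto simp: algebra_simps)

text \<open>
  A monic quartic is determined by four distinct roots. This makes Vieta's formulas available.
\<close>

lemma char_poly_factors:
  "[:-1, -1, -1, -1, 1:] = [:- lam 1, 1:] * [:- lam 2, 1:] * [:- lam 3, 1:] * [:- lam 4, 1:]"
proof (rule poly_eqI_degree_lead_coeff[where n = 4 and A = "lam ` {1..4}"])
  have "card (lam ` {1..4}) = card {1..4::nat}"
    by (rule card_image) (use roots in \<open>simp add: bij_betw_def\<close>)
  then show "card (lam ` {1..4}) \<ge> 4" by simp
  show "poly [:-1, -1, -1, -1, 1:] x =
      poly ([:- lam 1, 1:] * [:- lam 2, 1:] * [:- lam 3, 1:] * [:- lam 4, 1:]) x"
    if "x \<in> lam ` {1..4}" for x
  proof -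
    from that obtain i where i: "i \<in> {1..4}" "x = lam i" by blast
    then have "i = 1 \<or> i = 2 \<or> i = 3 \<or> i = 4" by auto
    then have "poly ([:- lam 1, 1:] * [:- lam 2, 1:] * [:- lam 3, 1:] * [:- lam 4, 1:]) x = 0"
      unfolding poly_mult using i(2) by auto
    moreover have "poly [:-1, -1, -1, -1, 1:] x = 0"
      using root_power4[OF i(1)] unfolding i(2) by (simp add: algebra_simps eval_nat_numeral)
    ultimately show ?thesis by simp
  qed
qed (simp_all add: numeral_eq_Suc)

lemma vieta:
  "lam 1 + lam 2 + lam 3 + lam 4 = 1"
  "lam 1*lam 2 + lam 1*lam 3 + lam 1*lam 4 + lam 2*lam 3 + lam 2*lam 4 + lam 3*lam 4 = -1"
  "lam 1*lam 2*lam 3 + lam 1*lam 2*lam 4 + lam 1*lam 3*lam 4 + lam 2*lam 3*lam 4 = 1"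
proof -
  have eq: "[:-1, -1, -1, -1, 1:] =
    [:lam 1*lam 2*lam 3*lam 4,
      - (lam 1*lam 2*lam 3 + lam 1*lam 2*lam 4 + lam 1*lam 3*lam 4 + lam 2*lam 3*lam 4),
      lam 1*lam 2 + lam 1*lam 3 + lam 1*lam 4 + lam 2*lam 3 + lam 2*lam 4 + lam 3*lam 4,
      - (lam 1 + lam 2 + lam 3 + lam 4), 1:]"
    unfolding char_poly_factors by (simp add: algebra_simps)
  show "lam 1 + lam 2 + lam 3 + lam 4 = 1"
    "lam 1*lam 2 + lam 1*lam 3 + lam 1*lam 4 + lam 2*lam 3 + lam 2*lam 4 + lam 3*lam 4 = -1"
    "lam 1*lam 2*lam 3 + lam 1*lam 2*lam 4 + lam 1*lam 3*lam 4 + lam 2*lam 3*lam 4 = 1"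
    using eq unfolding pCons_eq_iff by (metis neg_equal_iff_equal)+
qed

lemma power_sums:
  "(\<Sum>i=1..4. lam i ^ 0) = 4" "(\<Sum>i=1..4. lam i ^ 1) = 1" "(\<Sum>i=1..4. lam i ^ 2) = 3"
  "(\<Sum>i=1..4. lam i ^ 3) = 7" "(\<Sum>i=1..4. lam i ^ 4) = 15" "(\<Sum>i=1..4. lam i ^ 5) = 26"
  "(\<Sum>i=1..4. lam i ^ 6) = 51"
proof -
  have rec: "(\<Sum>i=1..4. lam i ^ (n + 4)) = (\<Sum>i=1..4. lam i ^ (n + 3)) + (\<Sum>i=1..4. lam i ^ (n + 2))
      + (\<Sum>i=1..4. lam i ^ (n + 1)) + (\<Sum>i=1..4. lam i ^ n)" for n
    unfolding sum.distrib[symmetric]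
    by (rule sum.cong) (simp_all add: power_add root_power4 power2_eq_square algebra_simps)
  show p0: "(\<Sum>i=1..4. lam i ^ 0) = 4" by simp
  show p1: "(\<Sum>i=1..4. lam i ^ 1) = 1" using vieta unfolding sum_1_4 by simp
  show p2: "(\<Sum>i=1..4. lam i ^ 2) = 3"
    unfolding sum_1_4 newton_four vieta by simp
  show p3: "(\<Sum>i=1..4. lam i ^ 3) = 7"
    unfolding sum_1_4 newton_four vieta by simp
  show p4: "(\<Sum>i=1..4. lam i ^ 4) = 15" using rec[of 0] p0 p1 p2 p3
    by (simp add: power2_eq_square power3_eq_cube mult.assoc)
  show p5: "(\<Sum>i=1..4. lam i ^ 5) = 26" using rec[of 1] p1 p2 p3 p4
    by (simp add: power2_eq_square power3_eq_cube mult.assoc)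
  show p6: "(\<Sum>i=1..4. lam i ^ 6) = 51" using rec[of 2] p2 p3 p4 p5
    by (simp add: power2_eq_square power3_eq_cube mult.assoc)
qed

text \<open>
  If the weights \<open>w i\<close> are values of one cubic polynomial at the roots, then the sum of
  \<open>w i * lam i ^ n\<close> for \<open>n = 0, \<dots>, 3\<close> is read off from the power sums 4, 1, 3, 7, 15, 26, 51. The
  common denominator \<open>D\<close> keeps the coefficients of the polynomial integral.
\<close>

lemma weighted_power_sum:
  assumes D: "D \<noteq> 0"
    and w: "\<And>i. i \<in> {1..4} \<Longrightarrow> D * w i = a + b * lam i + c * lam i ^ 2 + d * lam i ^ 3"
    and s: "D * s0 = 4*a + b + 3*c + 7*d" "D * s1 = a + 3*b + 7*c + 15*d"
      "D * s2 = 3*a + 7*b + 15*c + 26*d" "D * s3 = 7*a + 15*b + 26*c + 51*d"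
  shows "(\<Sum>i=1..4. w i * lam i ^ n) = tetra s0 s1 s2 s3 n"
proof -
  define u where "u n = (\<Sum>i=1..4. w i * lam i ^ n)" for n
  have u_eq: "D * u n = a * (\<Sum>i=1..4. lam i ^ n) + b * (\<Sum>i=1..4. lam i ^ (n + 1))
      + c * (\<Sum>i=1..4. lam i ^ (n + 2)) + d * (\<Sum>i=1..4. lam i ^ (n + 3))" for n
  proof -
    have "D * u n = (\<Sum>i=1..4. (D * w i) * lam i ^ n)"
      by (simp add: u_def sum_distrib_left mult_ac)
    also have "\<dots> = (\<Sum>i=1..4. (a + b * lam i + c * lam i ^ 2 + d * lam i ^ 3) * lam i ^ n)"
      by (rule sum.cong) (simp_all only: w)
    finally show ?thesis
      by (simp add: sum_distrib_left sum.distrib power_add power2_eq_square algebra_simps)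
  qed
  have "u n = tetra (u 0) (u 1) (u 2) (u 3) n"
  proof (rule tetra_unique)
    show "u (n + 4) = u (n + 3) + u (n + 2) + u (n + 1) + u n" for n
      unfolding u_def sum.distrib[symmetric]
      by (rule sum.cong) (simp_all add: power_add root_power4 power2_eq_square algebra_simps)
  qed
  moreover have "D * u 0 = D * s0" "D * u 1 = D * s1" "D * u 2 = D * s2" "D * u 3 = D * s3"
    using power_sums by (simp_all add: u_eq s power2_eq_square power3_eq_cube mult.assoc)
  then have "u 0 = s0" "u 1 = s1" "u 2 = s2" "u 3 = s3"
    using D by simp_all
  ultimately have "u n = tetra s0 s1 s2 s3 n" by (simp only:)
  then show ?thesis unfolding u_def .
qed

section \<open>The auxiliary sequences as weighted power sums\<close>

abbreviation cc :: "nat \<Rightarrow> complex" where "cc i \<equiv> coeff_c (lam i)"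

text \<open>
  Modulo the quartic, the denominator of \<open>coeff_c\<close> has the inverse
  \<open>(- 87 - 71 z - 61 z^2 + 86 z^3) / 563\<close>, found by solving a linear system in four unknowns; the
  higher powers are its powers, reduced modulo the quartic. The prime 563 is, up to sign, the
  discriminant of the quartic.
\<close>

lemma coeff_c_powers:
  assumes "z ^ 4 = z ^ 3 + z ^ 2 + z + 1"
  shows "- (z ^ 3) + 6 * z - 1 \<noteq> 0"
    and "563 * coeff_c z = - 87 - 71*z - 61*z^2 + 86*z^3"
    and "563 * coeff_c z ^ 2 = 6 + 9*z + 28*z^2 - 11*z^3"
    and "563^2 * coeff_c z ^ 3 = 512 + 1958*z - 1220*z^2 + 1157*z^3"
    and "563^2 * coeff_c z ^ 4 = 248 - 175*z + 255*z^2 + 210*z^3"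
    and "563^3 * coeff_c z ^ 5 = - 21851 + 24522*z + 20077*z^2 + 40593*z^3"
proof -
  have inv: "(- (z ^ 3) + 6 * z - 1) * (- 87 - 71*z - 61*z^2 + 86*z^3) = 563"
    using assms by algebra
  then show nz: "- (z ^ 3) + 6 * z - 1 \<noteq> 0" by auto
  show 1: "563 * coeff_c z = - 87 - 71*z - 61*z^2 + 86*z^3"
    unfolding coeff_c_def inv[symmetric] using nz by simp
  have "563 * (563 * coeff_c z ^ 2) = 563 * (6 + 9*z + 28*z^2 - 11*z^3)"
    using 1 assms by algebra
  from mult_left_cancel[of "563::complex", THEN iffD1, OF _ this]
  show 2: "563 * coeff_c z ^ 2 = 6 + 9*z + 28*z^2 - 11*z^3" by simp
  show 3: "563^2 * coeff_c z ^ 3 = 512 + 1958*z - 1220*z^2 + 1157*z^3"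
    using 1 2 assms by algebra
  show 4: "563^2 * coeff_c z ^ 4 = 248 - 175*z + 255*z^2 + 210*z^3"
    using 2 assms by algebra
  show 5: "563^3 * coeff_c z ^ 5 = - 21851 + 24522*z + 20077*z^2 + 40593*z^3"
    using 1 4 assms by algebra
qed

lemma seqs_as_power_sums:
  "seqT n = (\<Sum>i=1..4. cc i * lam i ^ n)"
  "seqU n = 563 * (\<Sum>i=1..4. cc i ^ 2 * lam i ^ n)"
  "seqV n = 563 * (\<Sum>i=1..4. cc i ^ 3 * lam i ^ n)"
  "seqW n = 563^2 * (\<Sum>i=1..4. cc i ^ 4 * lam i ^ n)"
  "seqX n = 563^2 * (\<Sum>i=1..4. cc i ^ 5 * lam i ^ n)"
  "seqY n = (\<Sum>i=1..4. inverse (cc i) * lam i ^ n)"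
proof -
  note c = coeff_c_powers[OF root_power4]
  show "seqT n = (\<Sum>i=1..4. cc i * lam i ^ n)"
    unfolding seqT_def
    by (rule weighted_power_sum[where D = 563 and a = "-87" and b = "-71" and c = "-61" and d = 86, symmetric])
      (use c(2) in simp_all)
  have "seqU n = (\<Sum>i=1..4. (563 * cc i ^ 2) * lam i ^ n)"
    unfolding seqU_def
    by (rule weighted_power_sum[where D = 1 and a = "6" and b = "9" and c = "28" and d = "-11", symmetric])
      (use c(3) in simp_all)
  then show "seqU n = 563 * (\<Sum>i=1..4. cc i ^ 2 * lam i ^ n)"
    by (simp add: sum_distrib_left mult_ac)
  have "seqV n = (\<Sum>i=1..4. (563 * cc i ^ 3) * lam i ^ n)"
    unfolding seqV_def
    by (rule weighted_power_sum[where D = 563 and a = "512" and b = "1958" and c = "-1220" and d = "1157", symmetric])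
      (use c(4) in simp_all)
  then show "seqV n = 563 * (\<Sum>i=1..4. cc i ^ 3 * lam i ^ n)"
    by (simp add: sum_distrib_left mult_ac)
  have "seqW n = (\<Sum>i=1..4. (563^2 * cc i ^ 4) * lam i ^ n)"
    unfolding seqW_def
    by (rule weighted_power_sum[where D = 1 and a = "248" and b = "-175" and c = "255" and d = "210", symmetric])
      (use c(5) in simp_all)
  then show "seqW n = 563^2 * (\<Sum>i=1..4. cc i ^ 4 * lam i ^ n)"
    by (simp add: sum_distrib_left mult_ac)
  have "seqX n = (\<Sum>i=1..4. (563^2 * cc i ^ 5) * lam i ^ n)"
    unfolding seqX_def
    by (rule weighted_power_sum[where D = 563 and a = "-21851" and b = "24522" and c = "20077" and d = "40593", symmetric])
      (use c(6) in simp_all)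
  then show "seqX n = 563^2 * (\<Sum>i=1..4. cc i ^ 5 * lam i ^ n)"
    by (simp add: sum_distrib_left mult_ac)
  show "seqY n = (\<Sum>i=1..4. inverse (cc i) * lam i ^ n)"
    unfolding seqY_def
    by (rule weighted_power_sum[where D = 1 and a = "-1" and b = 6 and c = 0 and d = "-1", symmetric])
      (simp_all add: coeff_c_def)
qed

lemma cc_nonzero: "i \<in> {1..4} \<Longrightarrow> cc i \<noteq> 0"
  using coeff_c_powers(1)[OF root_power4] by (simp add: coeff_c_def)

text \<open>
  Newton's formula for the fourth power sum determines the product of four numbers from their power
  sums of order 1, 2 and 4 if the first one vanishes. For the \<open>cc i\<close> these power sums are the
  initial values of \<open>T\<close>, \<open>U / 563\<close> and \<open>W / 563 ^ 2\<close>.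
\<close>

lemma prod_cc: "cc 1 * cc 2 * cc 3 * cc 4 = - 1 / 563"
proof -
  define e2 e3 where
    "e2 = cc 1 * cc 2 + cc 1 * cc 3 + cc 1 * cc 4 + cc 2 * cc 3 + cc 2 * cc 4 + cc 3 * cc 4"
    and "e3 = cc 1 * cc 2 * cc 3 + cc 1 * cc 2 * cc 4 + cc 1 * cc 3 * cc 4 + cc 2 * cc 3 * cc 4"
  have p1: "cc 1 + cc 2 + cc 3 + cc 4 = 0"
    using seqs_as_power_sums(1)[of 0] unfolding sum_1_4 by (simp add: seqT_def)
  have "563 * (cc 1 ^ 2 + cc 2 ^ 2 + cc 3 ^ 2 + cc 4 ^ 2) = 40"
    using seqs_as_power_sums(2)[of 0] unfolding sum_1_4 by (simp add: seqU_def)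
  then have p2: "563 * (0^2 - 2 * e2) = 40"
    unfolding newton_four p1 e2_def[symmetric] .
  have "e2 = (563 * (0^2 - 2 * e2)) / (- 1126)" by simp
  then have e2: "e2 = - 20 / 563" unfolding p2 by simp
  have "563^2 * (cc 1 ^ 4 + cc 2 ^ 4 + cc 3 ^ 4 + cc 4 ^ 4) = 3052"
    using seqs_as_power_sums(4)[of 0] unfolding sum_1_4 by (simp add: seqW_def)
  then show ?thesis
    unfolding newton_four p1 e2_def[symmetric] e3_def[symmetric] e2
    by (simp add: field_simps) algebra
qed

section \<open>Generating functions of the auxiliary sequences\<close>

definition x :: "nat \<Rightarrow> complex fps" where "x i = fps_const (cc i) * fps_exp (lam i)"

definition e1 :: "complex fps" where "e1 = x 1 + x 2 + x 3 + x 4"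
definition e2 :: "complex fps"
  where "e2 = x 1 * x 2 + x 1 * x 3 + x 1 * x 4 + x 2 * x 3 + x 2 * x 4 + x 3 * x 4"
definition e3 :: "complex fps"
  where "e3 = x 1 * x 2 * x 3 + x 1 * x 2 * x 4 + x 1 * x 3 * x 4 + x 2 * x 3 * x 4"
definition e4 :: "complex fps" where "e4 = x 1 * x 2 * x 3 * x 4"
definition p :: "nat \<Rightarrow> complex fps" where "p r = x 1 ^ r + x 2 ^ r + x 3 ^ r + x 4 ^ r"

lemma newton_x:
  "p 2 = e1^2 - 2*e2"
  "p 3 = e1^3 - 3*e1*e2 + 3*e3"
  "p 4 = e1^4 - 4*e1^2*e2 + 2*e2^2 + 4*e1*e3 - 4*e4"
  "p 5 = e1^5 - 5*e1^3*e2 + 5*e1*e2^2 + 5*e1^2*e3 - 5*e2*e3 - 5*e1*e4"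
  unfolding p_def e1_def e2_def e3_def e4_def by (rule newton_four)+

lemma x_power: "x i ^ r = fps_const (cc i ^ r) * fps_exp (of_nat r * lam i)"
  by (simp add: x_def power_mult_distrib fps_exp_power_mult)

lemma x_triple:
  "x i * x j * x k = fps_const (cc i * cc j * cc k) * fps_exp (lam i + lam j + lam k)"
  by (simp add: x_def fps_exp_add_mult fps_const_mult[symmetric] mult_ac del: fps_const_mult)

text \<open>
  Since \<open>x i ^ r = c i ^ r * exp (r * lam i * X)\<close>, the power sum \<open>p r\<close> generates
  \<open>c i ^ r * (r * lam i) ^ n\<close>; this is where the factors \<open>2 ^ n, \<dots>, 5 ^ n\<close> come from.
\<close>

lemma egf_dilated_power_sum:
  assumes "\<And>n. s n = D * (\<Sum>i=1..4. cc i ^ r * lam i ^ n)"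
  shows "egf (\<lambda>n. of_nat r ^ n * s n) = fps_const D * p r"
proof -
  have "(\<lambda>n. of_nat r ^ n * s n) = (\<lambda>n. D * (\<Sum>i=1..4. cc i ^ r * (of_nat r * lam i) ^ n))"
    by (simp add: assms sum_distrib_left power_mult_distrib mult_ac)
  then have "egf (\<lambda>n. of_nat r ^ n * s n) = fps_const D * (\<Sum>i=1..4. x i ^ r)"
    by (simp only: egf_cmult egf_sum egf_geometric x_power)
  then show ?thesis
    by (simp only: p_def sum_1_4)
qed

lemma egf_T: "egf seqT = e1"
proof -
  have "egf (\<lambda>n. of_nat 1 ^ n * seqT n) = fps_const 1 * p 1"
    by (rule egf_dilated_power_sum) (simp add: seqs_as_power_sums(1))
  then show ?thesis by (simp add: p_def e1_def)
qed

lemma egf_U: "egf (\<lambda>n. 2 ^ n * seqU n) = fps_const 563 * p 2"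
  using egf_dilated_power_sum[of seqU 563 2] seqs_as_power_sums(2) by simp

lemma egf_V: "egf (\<lambda>n. 3 ^ n * seqV n) = fps_const 563 * p 3"
  using egf_dilated_power_sum[of seqV 563 3] seqs_as_power_sums(3) by simp

lemma egf_W: "egf (\<lambda>n. 4 ^ n * seqW n) = fps_const (563^2) * p 4"
  using egf_dilated_power_sum[of seqW "563^2" 4] seqs_as_power_sums(4) by simp

lemma egf_X: "egf (\<lambda>n. 5 ^ n * seqX n) = fps_const (563^2) * p 5"
  using egf_dilated_power_sum[of seqX "563^2" 5] seqs_as_power_sums(5) by simp

lemma egf_t: "egf seqt = e2"
proof -
  have "fact n * egf seqt $ n = fact n * e2 $ n" for n
  proof -
    have "fact n * (fps_const 563 * p 2) $ n = 2 ^ n * seqU n"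
      unfolding egf_U[symmetric] by (rule egf_nth)
    then have U: "2 ^ n / 563 * seqU n = fact n * p 2 $ n"
      by (simp add: field_simps)
    have T: "(\<Sum>k=0..n. of_nat (n choose k) * seqT k * seqT (n - k)) = fact n * (e1 * e1) $ n"
      unfolding egf_T[symmetric] binomial_sum_egf[symmetric] by (simp add: mult.assoc)
    have "seqt n = 1 / 2 * (fact n * (e1 * e1) $ n - fact n * p 2 $ n)"
      unfolding seqt_def U T ..
    also have "\<dots> = fact n * e2 $ n"
      by (simp add: newton_x power2_eq_square numeral_fps_const algebra_simps)
    finally show ?thesis by (simp add: egf_nth)
  qed
  then show ?thesis by (simp add: fps_eq_iff)
qed

lemma exp_eq_e4: "fps_exp 1 = fps_const (- 563) * e4"
proof -
  have "e4 = fps_const (cc 1 * cc 2 * cc 3 * cc 4) * fps_exp (lam 1 + lam 2 + lam 3 + lam 4)"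
    by (simp add: e4_def x_def fps_exp_add_mult fps_const_mult[symmetric] mult_ac del: fps_const_mult)
  then show ?thesis
    unfolding prod_cc vieta by simp
qed

text \<open>
  Each product of three of the \<open>x i\<close> is \<open>e4\<close> divided by the remaining \<open>x l\<close>, that is, a multiple of
  \<open>exp X * exp (- lam l * X) / c l\<close>.
\<close>

lemma egf_Y: "egf (\<lambda>n. (- 1) ^ n * seqY n) * fps_exp 1 = fps_const (- 563) * e3"
proof -
  have triple: "fps_const (inverse (cc l)) * fps_exp (- lam l) * fps_exp 1 =
      fps_const (- 563) * (x i * x j * x k)"
    if "cc i * cc j * cc k * cc l = - 1 / 563" "lam i + lam j + lam k + lam l = 1" "l \<in> {1..4}"
    for i j k l
  proof -
    have "inverse (cc l) = - 563 * (cc i * cc j * cc k)"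
      using that(1) cc_nonzero[OF that(3)] by (simp add: field_simps)
    moreover have "- lam l + 1 = lam i + lam j + lam k"
      using that(2) by (simp add: algebra_simps)
    moreover note x_triple[of i j k]
    ultimately show ?thesis
      by (simp only: mult.assoc fps_exp_add_mult[symmetric] fps_const_mult[symmetric])
  qed
  have "(\<lambda>n. (- 1) ^ n * seqY n) = (\<lambda>n. \<Sum>i=1..4. inverse (cc i) * (- lam i) ^ n)"
    by (simp add: seqs_as_power_sums(6) sum_distrib_left power_minus[of "lam _"] mult_ac)
  then have "egf (\<lambda>n. (- 1) ^ n * seqY n) * fps_exp 1 =
      (\<Sum>i=1..4. fps_const (inverse (cc i)) * fps_exp (- lam i) * fps_exp 1)"
    by (simp only: egf_cmult egf_sum egf_geometric sum_distrib_right)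
  also have "\<dots> = fps_const (- 563) * e3"
    unfolding sum_1_4 e3_def
    using triple[of 2 3 4 1] triple[of 1 3 4 2] triple[of 1 2 4 3] triple[of 1 2 3 4] prod_cc vieta(1)
    by (simp add: ac_simps distrib_left)
  finally show ?thesis .
qed

text \<open>
  The extra factor \<open>f\<close> stands for the sequences between the index of \<open>Y\<close> and the free index.
\<close>

lemma egf_Y_mult_exp:
  "egf (\<lambda>n. (- 1) ^ n * seqY n) * (f * fps_exp 1) = fps_const (- 563) * (e3 * f)"
proof -
  have "egf (\<lambda>n. (- 1) ^ n * seqY n) * (f * fps_exp 1) =
      egf (\<lambda>n. (- 1) ^ n * seqY n) * fps_exp 1 * f" by (simp only: mult_ac)
  then show ?thesis by (simp only: egf_Y mult.assoc)
qed

lemma egf_t1: "egf (seqt1 lam) = e1 * e3 - 4 * e4"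
proof -
  have set: "{(i, j, l). 1 \<le> i \<and> i < j \<and> j < l \<and> l \<le> (4::nat)} = {(1,2,3), (1,2,4), (1,3,4), (2,3,4)}"
    by auto
  have sq: "x 1 * x 2 * x 3 * (x 1 + x 2 + x 3) + x 1 * x 2 * x 4 * (x 1 + x 2 + x 4)
      + x 1 * x 3 * x 4 * (x 1 + x 3 + x 4) + x 2 * x 3 * x 4 * (x 2 + x 3 + x 4) = e1 * e3 - 4 * e4"
    unfolding newton_four e1_def e3_def e4_def ..
  have "fact n * egf (seqt1 lam) $ n = fact n * (e1 * e3 - 4 * e4) $ n" for n
    unfolding egf_nth seqt1_def set x_triple[symmetric] x_def[symmetric] sq[symmetric]
    by (simp add: add.assoc)
  then show ?thesis
    by (simp add: fps_eq_iff)
qed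

end

theorem theorem6:
  fixes G I L M N P Q R S A E F H J K :: complex
    and lam :: "nat \<Rightarrow> complex"
    and n :: nat
  assumes roots: "bij_betw lam {1..4} {z. z ^ 4 - z ^ 3 - z ^ 2 - z - 1 = 0}"
    and A: "A = I + 2 * L + 2 * N + P + 2 * Q + 6 * R + 4 * S - 14"
    and E: "E = - I - 2 * L - N - Q - 3 * R - S + 5"
    and F: "F = 4 * G + I + 2 * L + 6 * N + 5 * P + 6 * Q + 18 * R + 16 * S - 50"
    and H: "H = - L - 2 * N - P - Q - 4 * R - 3 * S + 10"
    and J: "J = - G - I - 2 * L - M - 2 * P - 3 * Q - 6 * R - 7 * S + 20"
    and K: "K = - 2 * G - 2 * M - 2 * N - 5 * P - 2 * Q - 6 * R - 12 * S + 30"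
  shows "(\<Sum>(k1, k2, k3, k4, k5)\<in>comps5 n. multinom n [k1, k2, k3, k4, k5] *
            seqT k1 * seqT k2 * seqT k3 * seqT k4 * seqT k5)
    = A / 563 ^ 2 * 5 ^ n * seqX n
    + E / 563 ^ 2 * (\<Sum>k=0..n. of_nat (n choose k) * 4 ^ (n - k) * seqW (n - k) * seqT k)
    - F / 563 * (\<Sum>k=0..n. of_nat (n choose k) * seqT k)
    + G * (\<Sum>k=0..n. of_nat (n choose k) * seqt1 lam k * seqT (n - k))
    + H / 563 ^ 2 * (\<Sum>k=0..n. of_nat (n choose k) * 3 ^ (n - k) * 2 ^ k * seqV (n - k) * seqU k)
    + I / 563 * (\<Sum>k=0..n. of_nat (n choose k) * 3 ^ k * seqV k * seqt (n - k))
    - J / 563 ^ 2 * (\<Sum>(k1, k2, k3)\<in>comps3 n. multinom n [k1, k2, k3] *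
        (- 1) ^ k1 * 2 ^ k2 * seqY k1 * seqU k2)
    - K / 563 * (\<Sum>(k1, k2, k3)\<in>comps3 n. multinom n [k1, k2, k3] *
        (- 1) ^ k1 * seqY k1 * seqt k2)
    + L / 563 * (\<Sum>(k1, k2, k3)\<in>comps3 n. multinom n [k1, k2, k3] *
        3 ^ k1 * seqV k1 * seqT k2 * seqT k3)
    - M / 563 * (\<Sum>(k1, k2, k3, k4)\<in>comps4 n. multinom n [k1, k2, k3, k4] *
        (- 1) ^ k1 * seqY k1 * seqT k2 * seqT k3)
    + N / 563 ^ 2 * (\<Sum>(k1, k2, k3)\<in>comps3 n. multinom n [k1, k2, k3] *
        2 ^ k1 * seqU k1 * 2 ^ k2 * seqU k2 * seqT k3)
    + P * (\<Sum>(k1, k2, k3)\<in>comps3 n. multinom n [k1, k2, k3] *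
        seqt k1 * seqt k2 * seqT k3)
    + Q / 563 * (\<Sum>(k1, k2, k3)\<in>comps3 n. multinom n [k1, k2, k3] *
        2 ^ k1 * seqU k1 * seqt k2 * seqT k3)
    + R / 563 * (\<Sum>(k1, k2, k3, k4)\<in>comps4 n. multinom n [k1, k2, k3, k4] *
        2 ^ k1 * seqU k1 * seqT k2 * seqT k3 * seqT k4)
    + S * (\<Sum>(k1, k2, k3, k4)\<in>comps4 n. multinom n [k1, k2, k3, k4] *
        seqt k1 * seqT k2 * seqT k3 * seqT k4)"
proof -
  interpret tetranacci_roots lam
    by unfold_locales (rule roots)
  note egfs = egf_T egf_U egf_V egf_W egf_X egf_t egf_t1
  \<comment> \<open>rules that move the factors 563 out of a product and out of the coefficient extraction\<close>
  have pull: "(f * (fps_const r * g)) $ k = r * (f * g) $ k" for f g :: "complex fps" and r k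
    by (simp add: mult.left_commute[of f])
  note scalars = mult.assoc[of "fps_const r" for r] fps_mult_left_const_nth pull
  \<comment> \<open>Each sum becomes \<open>fact n\<close> times a coefficient of a product of symmetric functions; an index
    without a sequence is fed with the constant sequence \<open>1 ^ n\<close>, whose series is \<open>fps_exp 1\<close>.\<close>
  have lhs: "(\<Sum>(k1, k2, k3, k4, k5)\<in>comps5 n. multinom n [k1, k2, k3, k4, k5] *
      seqT k1 * seqT k2 * seqT k3 * seqT k4 * seqT k5) = fact n * (e1 ^ 5) $ n"
    using multinom5_sum_egf[of n seqT seqT seqT seqT seqT]
    by (simp add: egf_T mult.assoc eval_nat_numeral)
  have A': "5 ^ n * seqX n = 563^2 * (fact n * p 5 $ n)"
    using egf_nth[of n "\<lambda>n. 5 ^ n * seqX n"] unfolding egfs scalars by (simp add: mult_ac)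
  have E': "(\<Sum>k=0..n. of_nat (n choose k) * 4 ^ (n - k) * seqW (n - k) * seqT k) =
      563^2 * (fact n * (p 4 * e1) $ n)"
    using binomial_sum_egf[of n seqT "\<lambda>n. 4 ^ n * seqW n"] unfolding egfs scalars
    by (simp add: mult_ac)
  have F': "(\<Sum>k=0..n. of_nat (n choose k) * seqT k) = - 563 * (fact n * (e4 * e1) $ n)"
    using binomial_sum_egf[of n seqT "\<lambda>n. 1 ^ n"] unfolding egfs egf_geometric exp_eq_e4 scalars
    by (simp add: mult_ac)
  have G': "(\<Sum>k=0..n. of_nat (n choose k) * seqt1 lam k * seqT (n - k)) =
      fact n * ((e1 * e3 - 4 * e4) * e1) $ n"
    using binomial_sum_egf[of n "seqt1 lam" seqT] unfolding egfs
    by (simp add: mult_ac)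
  have H': "(\<Sum>k=0..n. of_nat (n choose k) * 3 ^ (n - k) * 2 ^ k * seqV (n - k) * seqU k) =
      563^2 * (fact n * (p 3 * p 2) $ n)"
    using binomial_sum_egf[of n "\<lambda>n. 2 ^ n * seqU n" "\<lambda>n. 3 ^ n * seqV n"] unfolding egfs scalars
    by (simp add: mult_ac)
  have I': "(\<Sum>k=0..n. of_nat (n choose k) * 3 ^ k * seqV k * seqt (n - k)) =
      563 * (fact n * (p 3 * e2) $ n)"
    using binomial_sum_egf[of n "\<lambda>n. 3 ^ n * seqV n" seqt] unfolding egfs scalars
    by (simp add: mult_ac)
  have J': "(\<Sum>(k1, k2, k3)\<in>comps3 n. multinom n [k1, k2, k3] *
      (- 1) ^ k1 * 2 ^ k2 * seqY k1 * seqU k2) = - (563^2) * (fact n * (e3 * p 2) $ n)"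
    using multinom3_sum_egf[of n "\<lambda>n. (- 1) ^ n * seqY n" "\<lambda>n. 2 ^ n * seqU n" "\<lambda>n. 1 ^ n"]
    unfolding egf_geometric egf_Y_mult_exp unfolding egfs scalars
    by (simp add: mult_ac)
  have K': "(\<Sum>(k1, k2, k3)\<in>comps3 n. multinom n [k1, k2, k3] *
      (- 1) ^ k1 * seqY k1 * seqt k2) = - 563 * (fact n * (e3 * e2) $ n)"
    using multinom3_sum_egf[of n "\<lambda>n. (- 1) ^ n * seqY n" seqt "\<lambda>n. 1 ^ n"]
    unfolding egf_geometric egf_Y_mult_exp unfolding egfs scalars
    by (simp add: mult_ac)
  have L': "(\<Sum>(k1, k2, k3)\<in>comps3 n. multinom n [k1, k2, k3] *
      3 ^ k1 * seqV k1 * seqT k2 * seqT k3) = 563 * (fact n * (p 3 * e1^2) $ n)"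
    using multinom3_sum_egf[of n "\<lambda>n. 3 ^ n * seqV n" seqT seqT]
    unfolding egfs scalars
    by (simp add: mult_ac power2_eq_square)
  have M': "(\<Sum>(k1, k2, k3, k4)\<in>comps4 n. multinom n [k1, k2, k3, k4] *
      (- 1) ^ k1 * seqY k1 * seqT k2 * seqT k3) = - 563 * (fact n * (e3 * e1^2) $ n)"
    using multinom4_sum_egf[of n "\<lambda>n. (- 1) ^ n * seqY n" seqT seqT "\<lambda>n. 1 ^ n"]
    unfolding egf_geometric egf_Y_mult_exp mult.assoc[of "egf seqT", symmetric] unfolding egfs scalars
    by (simp add: mult_ac power2_eq_square)
  have N': "(\<Sum>(k1, k2, k3)\<in>comps3 n. multinom n [k1, k2, k3] *
      2 ^ k1 * seqU k1 * 2 ^ k2 * seqU k2 * seqT k3) = 563^2 * (fact n * (p 2 ^ 2 * e1) $ n)"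
    using multinom3_sum_egf[of n "\<lambda>n. 2 ^ n * seqU n" "\<lambda>n. 2 ^ n * seqU n" seqT]
    unfolding egfs scalars
    by (simp add: mult_ac power2_eq_square[of "p 2"])
  have P': "(\<Sum>(k1, k2, k3)\<in>comps3 n. multinom n [k1, k2, k3] *
      seqt k1 * seqt k2 * seqT k3) = fact n * (e2^2 * e1) $ n"
    using multinom3_sum_egf[of n seqt seqt seqT] unfolding egfs
    by (simp add: mult_ac power2_eq_square)
  have Q': "(\<Sum>(k1, k2, k3)\<in>comps3 n. multinom n [k1, k2, k3] *
      2 ^ k1 * seqU k1 * seqt k2 * seqT k3) = 563 * (fact n * (p 2 * e2 * e1) $ n)"
    using multinom3_sum_egf[of n "\<lambda>n. 2 ^ n * seqU n" seqt seqT] unfolding egfs scalars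
    by (simp add: mult_ac)
  have R': "(\<Sum>(k1, k2, k3, k4)\<in>comps4 n. multinom n [k1, k2, k3, k4] *
      2 ^ k1 * seqU k1 * seqT k2 * seqT k3 * seqT k4) = 563 * (fact n * (p 2 * e1^3) $ n)"
    using multinom4_sum_egf[of n "\<lambda>n. 2 ^ n * seqU n" seqT seqT seqT] unfolding egfs scalars
    by (simp add: mult_ac power3_eq_cube)
  have S': "(\<Sum>(k1, k2, k3, k4)\<in>comps4 n. multinom n [k1, k2, k3, k4] *
      seqt k1 * seqT k2 * seqT k3 * seqT k4) = fact n * (e2 * e1^3) $ n"
    using multinom4_sum_egf[of n seqt seqT seqT seqT] unfolding egfs
    by (simp add: mult_ac power3_eq_cube)
  have coeffs: "fps_const I + 2 * fps_const L + 2 * fps_const N + fps_const P + 2 * fps_const Q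
        + 6 * fps_const R + 4 * fps_const S - 14 = fps_const A"
    "- fps_const I - 2 * fps_const L - fps_const N - fps_const Q - 3 * fps_const R
        - fps_const S + 5 = fps_const E"
    "4 * fps_const G + fps_const I + 2 * fps_const L + 6 * fps_const N + 5 * fps_const P
        + 6 * fps_const Q + 18 * fps_const R + 16 * fps_const S - 50 = fps_const F"
    "- fps_const L - 2 * fps_const N - fps_const P - fps_const Q - 4 * fps_const R
        - 3 * fps_const S + 10 = fps_const H"
    "- fps_const G - fps_const I - 2 * fps_const L - fps_const M - 2 * fps_const P
        - 3 * fps_const Q - 6 * fps_const R - 7 * fps_const S + 20 = fps_const J"
    "- 2 * fps_const G - 2 * fps_const M - 2 * fps_const N - 5 * fps_const P - 2 * fps_const Q
        - 6 * fps_const R - 12 * fps_const S + 30 = fps_const K"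
    by (simp_all add: A E F H J K numeral_fps_const)
  note main = e1_power5_expansion[OF newton_x refl, where G = "fps_const G" and I = "fps_const I"
    and L = "fps_const L" and M = "fps_const M" and N = "fps_const N" and P = "fps_const P"
    and Q = "fps_const Q" and R = "fps_const R" and S = "fps_const S", unfolded coeffs]
  show ?thesis
    unfolding lhs E' F' G' H' I' J' K' L' M' N' P' Q' R' S'
    unfolding main mult.assoc[of "A / 563^2" "5 ^ n"] A'
    unfolding fps_add_nth fps_mult_left_const_nth
    by (simp add: algebra_simps)
qed

end
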